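(* Let $\mathcal{H}$ be a complex Hilbert space and let $T\in\mathbb{B}(\mathcal{H})$ be an operator with the polar decomposition $T=U|T|$. Then \[ \begin{aligned} \omega(T)&\le \frac12\Big(\|T\|+\|T\|^{\frac12}\,\omega\big(U|T|^{\frac12}\big)\Big)\\ &\le \frac12\Big(\|T\|+\|T\|^{\frac12}\,\big\|U|T|^{\frac12}\big\|\Big)\\ &\le \frac12\Big(\|T\|+\|T\|^{\frac12}\,\|U\|\,\|T\|^{\frac12}\Big)\\ &\le \|T\|. \end{aligned} \]
   Context: $\mathbb{B}(\mathcal{H})$ is the algebra of all bounded linear operators on $\mathcal{H}$. For $X\in\mathbb{B}(\mathcal{H})$, $|X|=(X^*X)^{1/2}$, the numerical radius is $\omega(X)=\sup_{\|x\|=1}|\langle Xx,x\rangle|$ and the operator norm is $\|X\|=\sup_{\|x\|=1}\|Xx\|$. In the polar decomposition $T=U|T|$, $U$ is a partial isometry. *)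

theory Defs
  imports "HOL-Analysis.Analysis"
begin

text \<open>
  A complex inner product space is a complex vector space with a Hermitian form that is linear in
  its first argument. It is built on top of \<^class>\<open>real_inner\<close>, whose inner product is required
  to be the real part of the Hermitian form. As \<^term>\<open>cinner x x\<close> is real by Hermitian symmetry,
  positive definiteness and \<open>norm x = sqrt (cinner x x)\<close> are inherited from \<^class>\<open>real_inner\<close>.
\<close>

class complex_inner = real_inner +
  fixes scaleC :: "complex \<Rightarrow> 'a \<Rightarrow> 'a" (infixr "*\<^sub>C" 75)
    and cinner :: "'a \<Rightarrow> 'a \<Rightarrow> complex"
  assumes scaleC_add_right: "a *\<^sub>C (x + y) = a *\<^sub>C x + a *\<^sub>C y"
    and scaleC_add_left: "(a + b) *\<^sub>C x = a *\<^sub>C x + b *\<^sub>C x"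
    and scaleC_scaleC: "a *\<^sub>C (b *\<^sub>C x) = (a * b) *\<^sub>C x"
    and scaleC_of_real: "complex_of_real r *\<^sub>C x = r *\<^sub>R x"
    and cinner_commute: "cinner x y = cnj (cinner y x)"
    and cinner_add_left: "cinner (x + y) z = cinner x z + cinner y z"
    and cinner_scaleC_left: "cinner (a *\<^sub>C x) y = a * cinner x y"
    and Re_cinner: "Re (cinner x y) = inner x y"

class complex_hilbert = complex_inner + complete_space

instantiation complex :: complex_hilbert
begin

definition scaleC_complex :: "complex \<Rightarrow> complex \<Rightarrow> complex"
  where "scaleC_complex a x = a * x"

definition cinner_complex :: "complex \<Rightarrow> complex \<Rightarrow> complex"
  where "cinner_complex x y = x * cnj y"

instance
  by standard
    (simp_all add: scaleC_complex_def cinner_complex_def inner_complex_def algebra_simps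
      scaleR_conv_of_real)

end

lemma cinner_self: "cinner x x = complex_of_real ((norm x)\<^sup>2)"
  using cinner_commute [of x x] Re_cinner [of x x]
  by (simp add: complex_eq_iff power2_norm_eq_inner)

definition bounded_clinear :: "('a::complex_inner \<Rightarrow> 'b::complex_inner) \<Rightarrow> bool"
  where "bounded_clinear f \<longleftrightarrow> bounded_linear f \<and> (\<forall>c x. f (c *\<^sub>C x) = c *\<^sub>C f x)"

text \<open>For a bounded complex-linear map on a Hilbert space the adjoint exists and is unique.\<close>

definition cadjoint :: "('a::complex_hilbert \<Rightarrow> 'a) \<Rightarrow> 'a \<Rightarrow> 'a"
  where "cadjoint T = (THE S. \<forall>x y. cinner (T x) y = cinner x (S y))"

definition positive_op :: "('a::complex_hilbert \<Rightarrow> 'a) \<Rightarrow> bool"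
  where "positive_op A \<longleftrightarrow> bounded_clinear A \<and> (\<forall>x. cinner (A x) x \<in> \<real>\<^sub>\<ge>\<^sub>0)"

text \<open>Every positive operator has exactly one positive square root.\<close>

definition op_sqrt :: "('a::complex_hilbert \<Rightarrow> 'a) \<Rightarrow> 'a \<Rightarrow> 'a"
  where "op_sqrt A = (THE S. positive_op S \<and> S \<circ> S = A)"

definition abs_op :: "('a::complex_hilbert \<Rightarrow> 'a) \<Rightarrow> 'a \<Rightarrow> 'a"
  where "abs_op T = op_sqrt (cadjoint T \<circ> T)"

text \<open>A partial isometry is isometric on the orthogonal complement of its kernel.\<close>

definition partial_isometry :: "('a::complex_hilbert \<Rightarrow> 'a) \<Rightarrow> bool"
  where "partial_isometry U \<longleftrightarrow>
    bounded_clinear U \<and> (\<forall>x. (\<forall>y. U y = 0 \<longrightarrow> cinner x y = 0) \<longrightarrow> norm (U x) = norm x)"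

text \<open>
  The element \<open>0\<close> makes this the supremum in \<open>[0, \<infinity>)\<close>; it only matters for the zero space, which
  has no unit vectors and where the supremum of the empty set of reals would be unspecified.
  The operator norm is the library constant \<^const>\<open>onorm\<close>.
\<close>

definition numerical_radius :: "('a::complex_hilbert \<Rightarrow> 'a) \<Rightarrow> real"
  where "numerical_radius X = Sup (insert 0 {cmod (cinner (X x) x) | x. norm x = 1})"

end

theory Submission
  imports Defs
begin

text \<open>
  Put \<open>A = |T|\<^sup>1\<^sup>/\<^sup>2\<close>, \<open>a = \<parallel>T\<parallel>\<^sup>1\<^sup>/\<^sup>2\<close> and \<open>C = UA\<close>, so that \<open>T = CA\<close>. Since \<open>A\<close> is positive with
  norm at most \<open>a\<close>, its spectrum lies in \<open>[0, a]\<close>, and so \<open>A\<close> differs from the midpoint \<open>a/2\<close>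
  by an operator of norm at most \<open>a/2\<close>. In the splitting \<open>CA = (a/2) C + C (A - a/2)\<close> the first
  summand has numerical radius \<open>(a/2) \<omega>(C)\<close> and the second has norm at most \<open>(a/2) \<parallel>C\<parallel>\<close>. Hence
  \<open>\<omega>(T) \<le> (a/2) (\<parallel>C\<parallel> + \<omega>(C))\<close> (lemma \<open>numerical_radius_comp_positive_le\<close>), and
  \<open>\<parallel>C\<parallel> \<le> \<parallel>U\<parallel> \<parallel>A\<parallel> \<le> a\<close> turns this into the first inequality. The rest of the chain follows from
  \<open>\<omega> \<le> \<parallel>\<cdot>\<parallel>\<close> and \<open>\<parallel>U\<parallel> \<le> 1\<close>.

  Adjoint and square root are definite descriptions, so most of the work is to show that they
  denote what they should. The adjoint comes from the Riesz representation theorem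
  (\<open>ex_riesz_representative\<close>), which rests on orthogonal projection onto closed subspaces; the same
  projection yields \<open>\<parallel>U\<parallel> \<le> 1\<close>. The square root is the limit of a quadratic iteration
  (\<open>ex_positive_sqrt\<close>). It commutes with everything that commutes with the given operator, and this
  is what makes it unique (\<open>commuting_positive_sqrt_unique\<close>). This part is carried out for the real
  inner product, as a complex-linear operator is positive exactly when it is symmetric and
  nonnegative for the real inner product (\<open>positive_op_iff\<close>).
\<close>

instance complex_hilbert \<subseteq> banach ..

section \<open>Orthogonal projection and representation of functionals\<close>

text \<open>
  The projection is the point of \<open>S\<close> nearest to \<open>x\<close>. By the parallelogram law a minimising
  sequence is Cauchy, because the midpoint of two of its members lies in \<open>S\<close> and cannot be
  closer than the infimum. At the nearest point the first variation in the directions of \<open>S\<close>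
  vanishes, which is the orthogonality.
\<close>

lemma ex_orthogonal_projection:
  fixes S :: "'a::{real_inner,banach} set"
  assumes S: "subspace S" "closed S"
  shows "\<exists>z\<in>S. \<forall>y\<in>S. inner (x - z) y = 0"
proof -
  define d where "d = Inf ((\<lambda>y. (norm (x - y))\<^sup>2) ` S)"
  have bdd: "bdd_below ((\<lambda>y. (norm (x - y))\<^sup>2) ` S)"
    by (rule bdd_belowI[of _ 0]) auto
  have d_le: "d \<le> (norm (x - y))\<^sup>2" if "y \<in> S" for y
    unfolding d_def using that by (intro cInf_lower bdd) auto
  have ne: "(\<lambda>y. (norm (x - y))\<^sup>2) ` S \<noteq> {}"
    using subspace_0[OF S(1)] by auto
  have "\<exists>y\<in>S. (norm (x - y))\<^sup>2 < d + inverse (Suc n)" for n :: nat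
  proof -
    have "Inf ((\<lambda>y. (norm (x - y))\<^sup>2) ` S) < d + inverse (Suc n)"
      by (simp add: d_def)
    from cInf_lessD[OF ne this] show ?thesis by auto
  qed
  then obtain y where y: "\<And>n. y n \<in> S" "\<And>n::nat. (norm (x - y n))\<^sup>2 < d + inverse (Suc n)"
    by metis
  have par: "(norm (y m - y n))\<^sup>2 \<le> 2 * inverse (Suc m) + 2 * inverse (Suc n)" for m n
  proof -
    have "(1/2) *\<^sub>R (y m + y n) \<in> S"
      using S(1) y(1) by (simp add: subspace_add subspace_mul)
    from d_le[OF this] have "d \<le> (norm (x - (1/2) *\<^sub>R (y m + y n)))\<^sup>2" .
    moreover have "(norm (y m - y n))\<^sup>2 = 2 * (norm (x - y m))\<^sup>2 + 2 * (norm (x - y n))\<^sup>2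
        - 4 * (norm (x - (1/2) *\<^sub>R (y m + y n)))\<^sup>2"
      by (simp add: power2_norm_eq_inner inner_diff_left inner_diff_right inner_add_left
          inner_add_right inner_commute algebra_simps)
    ultimately show ?thesis using y(2)[of m] y(2)[of n] by linarith
  qed
  have "Cauchy y"
  proof (rule metric_CauchyI)
    fix e :: real assume e: "0 < e"
    obtain N where N: "inverse (of_nat (Suc N)) < e\<^sup>2 / 4"
      using reals_Archimedean[of "e\<^sup>2 / 4"] e by auto
    have "dist (y m) (y n) < e" if mn: "m \<ge> N" "n \<ge> N" for m n
    proof -
      have "inverse (real (Suc m)) \<le> inverse (real (Suc N))" "inverse (real (Suc n)) \<le> inverse (real (Suc N))"
        using mn by (auto intro!: le_imp_inverse_le)
      with par[of m n] N have "(norm (y m - y n))\<^sup>2 < e\<^sup>2" by linarith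
      then show ?thesis using e by (simp add: dist_norm power_less_imp_less_base)
    qed
    then show "\<exists>M. \<forall>m\<ge>M. \<forall>n\<ge>M. dist (y m) (y n) < e" by blast
  qed
  then obtain z where z: "y \<longlonglongrightarrow> z"
    using Cauchy_convergent_iff convergent_def by blast
  have zS: "z \<in> S"
    using S(2) y(1) z closed_sequentially by blast
  have lim: "(\<lambda>n. (norm (x - y n))\<^sup>2) \<longlonglongrightarrow> (norm (x - z))\<^sup>2"
    by (intro tendsto_intros z)
  have lim': "(\<lambda>n. d + inverse (real (Suc n))) \<longlonglongrightarrow> d + 0"
    by (intro tendsto_intros LIMSEQ_inverse_real_of_nat)
  have zd: "(norm (x - z))\<^sup>2 \<le> d"
    using LIMSEQ_le[OF lim lim'] y(2) less_imp_le by auto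
  have "inner (x - z) w = 0" if w: "w \<in> S" for w
  proof (cases "w = 0")
    case False
    \<comment> \<open>this step length minimises the distance of \<open>x\<close> to the line \<open>z + t w\<close>\<close>
    define t where "t = inner (x - z) w / (norm w)\<^sup>2"
    have "z + t *\<^sub>R w \<in> S"
      using S(1) zS w by (simp add: subspace_add subspace_mul)
    from order_trans[OF zd d_le[OF this]]
    have "(norm (x - z))\<^sup>2 \<le> (norm ((x - z) - t *\<^sub>R w))\<^sup>2"
      by (simp add: algebra_simps)
    also have "\<dots> = (norm (x - z))\<^sup>2 - 2 * t * inner (x - z) w + t\<^sup>2 * (norm w)\<^sup>2"
      by (simp add: power2_norm_eq_inner inner_diff_left[of "x - z"] inner_diff_right[of _ "x - z"]
          inner_commute power2_eq_square[of t])
    also have "t\<^sup>2 * (norm w)\<^sup>2 = t * inner (x - z) w"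
      using False by (simp add: t_def power2_eq_square)
    finally have "t * inner (x - z) w \<le> 0" by simp
    then have "(inner (x - z) w)\<^sup>2 / (norm w)\<^sup>2 \<le> 0"
      by (simp add: t_def power2_eq_square)
    then show ?thesis using False by (simp add: divide_le_0_iff)
  qed simp
  with zS show ?thesis by blast
qed

text \<open>
  The kernel of a nonzero functional has codimension one, so the functional is determined by its
  value at one nonzero vector orthogonal to the kernel; the projection supplies this vector.
\<close>

lemma ex_riesz_representative:
  fixes f :: "'a::{real_inner,banach} \<Rightarrow> real"
  assumes f: "bounded_linear f"
  shows "\<exists>z. \<forall>x. f x = inner x z"
proof (cases "\<forall>x. f x = 0")
  case True
  then show ?thesis by (intro exI[of _ 0]) simp
next
  case False
  interpret bounded_linear f by fact
  obtain u where u: "f u \<noteq> 0" using False by blast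
  have "closed (f -` {0})"
    by (intro closed_vimage continuous_on closed_singleton continuous_on_id)
  moreover have "subspace (f -` {0})"
    by (auto simp: subspace_def add scaleR)
  ultimately obtain p where p: "f p = 0" "\<And>y. f y = 0 \<Longrightarrow> inner (u - p) y = 0"
    using ex_orthogonal_projection[of "f -` {0}" u] by auto
  define w where "w = u - p"
  have fw: "f w \<noteq> 0" using u p by (simp add: w_def diff)
  then have w0: "w \<noteq> 0" using zero by auto
  have "f x = inner x ((f w / inner w w) *\<^sub>R w)" for x
  proof -
    have "f (x - (f x / f w) *\<^sub>R w) = 0"
      using fw by (simp add: diff scaleR)
    from p(2)[OF this] have "inner w x = f x / f w * inner w w"
      by (simp add: w_def[symmetric] inner_diff_right)
    then show ?thesis using fw w0 by (simp add: inner_commute)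
  qed
  then show ?thesis by blast
qed

section \<open>Square roots of positive operators\<close>

definition positive_symmetric :: "('a::real_inner \<Rightarrow> 'a) \<Rightarrow> bool"
  where "positive_symmetric A \<longleftrightarrow>
    (\<forall>x y. inner (A x) y = inner x (A y)) \<and> (\<forall>x. 0 \<le> inner (A x) x)"

lemma positive_symmetric_sym: "positive_symmetric A \<Longrightarrow> inner (A x) y = inner x (A y)"
  unfolding positive_symmetric_def by blast

lemma positive_symmetric_nonneg: "positive_symmetric A \<Longrightarrow> 0 \<le> inner (A x) x"
  unfolding positive_symmetric_def by blast

text \<open>
  This is \<open>A\<^sup>2 \<le> a A\<close>, which for a positive operator follows from \<open>\<parallel>A\<parallel> \<le> a\<close> without any functional
  calculus: evaluate the form of \<open>A\<close> at \<open>x - A x / a\<close>.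
\<close>

lemma positive_symmetric_norm_le_form:
  fixes A :: "'a::real_inner \<Rightarrow> 'a"
  assumes A: "positive_symmetric A" "bounded_linear A" "\<And>x. norm (A x) \<le> a * norm x" "0 < a"
  shows "(norm (A x))\<^sup>2 \<le> a * inner (A x) x"
proof -
  interpret A: bounded_linear A by fact
  let ?v = "x - (1/a) *\<^sub>R A x"
  note sym = positive_symmetric_sym[OF A(1)]
  have "0 \<le> inner (A ?v) ?v"
    by (rule positive_symmetric_nonneg[OF A(1)])
  also have "\<dots> = inner (A x) x - 2 / a * (norm (A x))\<^sup>2 + inner (A (A x)) (A x) / a\<^sup>2"
    by (simp add: A.diff A.scaleR inner_diff_left inner_diff_right sym[of "A x" x]
        power2_norm_eq_inner power2_eq_square[of a] diff_divide_distrib)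
  also have "inner (A (A x)) (A x) \<le> norm (A (A x)) * norm (A x)"
    by (rule norm_cauchy_schwarz)
  also have "\<dots> \<le> (a * norm (A x)) * norm (A x)"
    by (intro mult_right_mono A(3)) simp
  finally show ?thesis
    using A(4) by (simp add: field_simps power2_eq_square)
qed

lemma positive_symmetric_form_eq_0:
  fixes A :: "'a::real_inner \<Rightarrow>\<^sub>L 'a"
  assumes A: "positive_symmetric A" and x: "inner (A x) x = 0"
  shows "A x = 0"
proof -
  \<comment> \<open>the \<open>1\<close> keeps the bound strictly positive\<close>
  have "norm (A y) \<le> (norm A + 1) * norm y" for y
    using norm_blinfun[of A y] by (simp add: distrib_right add_increasing2)
  from positive_symmetric_norm_le_form[OF A blinfun.bounded_linear_right this, of x] x
  show ?thesis by (simp add: add_nonneg_pos)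
qed

text \<open>
  The spectrum of \<open>A\<close> lies within \<open>a/2\<close> of the midpoint of \<open>[0, a]\<close>. Expanding the square shows that
  the bound is equivalent to \<open>A\<^sup>2 \<le> a A\<close>.
\<close>

lemma positive_symmetric_reflect_le:
  fixes A :: "'a::real_inner \<Rightarrow> 'a"
  assumes A: "positive_symmetric A" "bounded_linear A" "\<And>x. norm (A x) \<le> a * norm x" "0 < a"
  shows "norm (A x - (a/2) *\<^sub>R x) \<le> a/2 * norm x"
proof -
  have "(norm (A x - (a/2) *\<^sub>R x))\<^sup>2 = (norm (A x))\<^sup>2 - a * inner (A x) x + (a/2 * norm x)\<^sup>2"
    by (simp add: power2_norm_eq_inner inner_diff_left inner_diff_right inner_commute
        power_mult_distrib power2_eq_square[of a] power_divide)
  also have "\<dots> \<le> (a/2 * norm x)\<^sup>2"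
    using positive_symmetric_norm_le_form[OF A] by simp
  finally show ?thesis
    by (rule power2_le_imp_le) (use A(4) in auto)
qed

lemma positive_symmetric_compl_le:
  fixes A :: "'a::real_inner \<Rightarrow> 'a"
  assumes A: "positive_symmetric A" "bounded_linear A" "\<And>x. norm (A x) \<le> a * norm x" "0 < a"
  shows "norm (x - (1/a) *\<^sub>R A x) \<le> norm x"
proof -
  have "norm (a *\<^sub>R x - A x) = norm ((a/2) *\<^sub>R x - (A x - (a/2) *\<^sub>R x))"
    by (simp add: algebra_simps flip: scaleR_add_left)
  also have "\<dots> \<le> a * norm x"
    using norm_triangle_ineq4[of "(a/2) *\<^sub>R x" "A x - (a/2) *\<^sub>R x"]
      positive_symmetric_reflect_le[OF A, of x] A(4) by simp
  finally have "norm (a *\<^sub>R (x - (1/a) *\<^sub>R A x)) \<le> a * norm x"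
    using A(4) by (simp add: scaleR_diff_right)
  then show ?thesis using A(4) by simp
qed

text \<open>
  If \<open>Y = (B + Y\<^sup>2) / 2\<close>, then \<open>(1 - Y)\<^sup>2 = 1 - B\<close>. So a fixed point of this iteration yields a square
  root of \<open>1 - B\<close>.
\<close>

primrec sqrt_iter :: "('a::real_normed_vector \<Rightarrow>\<^sub>L 'a) \<Rightarrow> nat \<Rightarrow> 'a \<Rightarrow>\<^sub>L 'a" where
  "sqrt_iter B 0 = 0"
| "sqrt_iter B (Suc n) = (1/2) *\<^sub>R (B + (sqrt_iter B n o\<^sub>L sqrt_iter B n))"

text \<open>
  The same iteration for the number \<open>B = 1\<close>. It increases to a limit, and it dominates the
  operator iteration and its increments whenever \<open>norm B \<le> 1\<close>. In the boundary case \<open>norm B = 1\<close>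
  the iteration map need not be a strict contraction on the unit ball, so convergence
  is obtained from this comparison instead.
\<close>

primrec sqrt_majorant :: "nat \<Rightarrow> real" where
  "sqrt_majorant 0 = 0"
| "sqrt_majorant (Suc n) = (1 + (sqrt_majorant n)\<^sup>2) / 2"

lemma sqrt_majorant_bounds: "0 \<le> sqrt_majorant n \<and> sqrt_majorant n \<le> 1"
  by (induction n) (auto simp: power_le_one)

lemma incseq_sqrt_majorant: "incseq sqrt_majorant"
proof (rule incseq_SucI)
  fix n
  have "0 \<le> (1 - sqrt_majorant n)\<^sup>2" by simp
  then show "sqrt_majorant n \<le> sqrt_majorant (Suc n)"
    by (simp add: power2_eq_square algebra_simps)
qed

context
  fixes B :: "'a::real_normed_vector \<Rightarrow>\<^sub>L 'a"
  assumes B: "norm B \<le> 1"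
begin

lemma norm_sqrt_iter: "norm (sqrt_iter B n) \<le> sqrt_majorant n"
proof (induction n)
  case (Suc n)
  have "norm (sqrt_iter B n o\<^sub>L sqrt_iter B n) \<le> sqrt_majorant n * sqrt_majorant n"
    by (rule order_trans[OF norm_blinfun_compose]) (intro mult_mono Suc norm_ge_zero; simp add: sqrt_majorant_bounds)
  then show ?case
    using B norm_triangle_ineq[of B "sqrt_iter B n o\<^sub>L sqrt_iter B n"]
    by (simp add: power2_eq_square)
qed simp

text \<open>
  The difference of two squares is \<open>Z\<^sup>2 - Y\<^sup>2 = Z (Z - Y) + (Z - Y) Y\<close>. This holds without
  commutativity. Taking norms and inserting the bounds for \<open>Z\<close>, \<open>Y\<close> and \<open>Z - Y\<close> produces exactly the
  corresponding difference of squares for the majorant.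
\<close>

lemma norm_sqrt_iter_step:
  "norm (sqrt_iter B (Suc n) - sqrt_iter B n) \<le> sqrt_majorant (Suc n) - sqrt_majorant n"
proof (induction n)
  case 0
  then show ?case using B by simp
next
  case (Suc n)
  let ?Y = "sqrt_iter B" and ?y = "sqrt_majorant"
  have "?Y (Suc (Suc n)) - ?Y (Suc n) =
      (1/2) *\<^sub>R ((?Y (Suc n) o\<^sub>L ?Y (Suc n)) - (?Y n o\<^sub>L ?Y n))"
    unfolding sqrt_iter.simps(2)[of B "Suc n"]
    by (subst (3) sqrt_iter.simps(2)) (simp only: scaleR_diff_right[symmetric] add_diff_cancel_left)
  also have "(?Y (Suc n) o\<^sub>L ?Y (Suc n)) - (?Y n o\<^sub>L ?Y n) =
      (?Y (Suc n) o\<^sub>L (?Y (Suc n) - ?Y n)) + ((?Y (Suc n) - ?Y n) o\<^sub>L ?Y n)"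
    by (simp del: sqrt_iter.simps add: bounded_bilinear.diff_left[OF bounded_bilinear_blinfun_compose]
        bounded_bilinear.diff_right[OF bounded_bilinear_blinfun_compose])
  finally have "norm (?Y (Suc (Suc n)) - ?Y (Suc n)) =
      norm ((?Y (Suc n) o\<^sub>L (?Y (Suc n) - ?Y n)) + ((?Y (Suc n) - ?Y n) o\<^sub>L ?Y n)) / 2"
    by simp
  also have "\<dots> \<le> (norm (?Y (Suc n)) * norm (?Y (Suc n) - ?Y n) + norm (?Y (Suc n) - ?Y n) * norm (?Y n)) / 2"
    by (intro divide_right_mono order_trans[OF norm_triangle_ineq] add_mono norm_blinfun_compose) simp
  also have "\<dots> \<le> (?y (Suc n) * (?y (Suc n) - ?y n) + (?y (Suc n) - ?y n) * ?y n) / 2"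
    using sqrt_majorant_bounds[of n] sqrt_majorant_bounds[of "Suc n"] incseq_SucD[OF incseq_sqrt_majorant, of n]
    by (intro divide_right_mono add_mono mult_mono Suc norm_sqrt_iter) auto
  also have "\<dots> = ((?y (Suc n))\<^sup>2 - (?y n)\<^sup>2) / 2"
    by (simp del: sqrt_majorant.simps add: power2_eq_square algebra_simps)
  also have "\<dots> = ?y (Suc (Suc n)) - ?y (Suc n)"
    by (simp add: field_simps)
  finally show ?case .
qed

lemma norm_sqrt_iter_diff:
  "norm (sqrt_iter B (n + k) - sqrt_iter B n) \<le> sqrt_majorant (n + k) - sqrt_majorant n"
proof (induction k)
  case (Suc k)
  show ?case
    using norm_sqrt_iter_step[of "n + k"] Suc
      norm_triangle_ineq[of "sqrt_iter B (Suc (n + k)) - sqrt_iter B (n + k)" "sqrt_iter B (n + k) - sqrt_iter B n"]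
    by (simp del: sqrt_iter.simps sqrt_majorant.simps)
qed simp

end

lemma convergent_sqrt_iter:
  fixes B :: "'a::banach \<Rightarrow>\<^sub>L 'a"
  assumes B: "norm B \<le> 1"
  shows "convergent (sqrt_iter B)"
proof -
  have "convergent sqrt_majorant"
    using incseq_convergent[OF incseq_sqrt_majorant, of 1] sqrt_majorant_bounds convergent_def by metis
  then have C: "Cauchy sqrt_majorant" by (rule convergent_Cauchy)
  have "Cauchy (sqrt_iter B)"
  proof (rule CauchyI')
    fix e :: real assume "0 < e"
    then obtain M where M: "\<And>m n. m \<ge> M \<Longrightarrow> n \<ge> M \<Longrightarrow> norm (sqrt_majorant m - sqrt_majorant n) < e"
      using CauchyD[OF C] by blast
    have "norm (sqrt_iter B m - sqrt_iter B n) < e" if "m \<ge> M" "n > m" for m n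
    proof -
      have "norm (sqrt_iter B (m + (n - m)) - sqrt_iter B m) < e"
        using norm_sqrt_iter_diff[OF B, of m "n - m"] M[of n m] that by simp
      then show ?thesis using that by (simp add: norm_minus_commute)
    qed
    then show "\<exists>M. \<forall>m\<ge>M. \<forall>n>m. dist (sqrt_iter B m) (sqrt_iter B n) < e"
      unfolding dist_norm by blast
  qed
  then show ?thesis using Cauchy_convergent_iff by blast
qed

text \<open>
  After scaling, \<open>P = M (1 - B)\<close> with \<open>norm B \<le> 1\<close>, and the root is \<open>\<surd>M (1 - Y)\<close> for the limit \<open>Y\<close>
  of the iteration. The iterates are polynomials in \<open>B\<close> with real coefficients, so they are
  symmetric and commute with whatever commutes with \<open>P\<close>; both properties pass to the limit.
  Positivity of the root is \<open>norm Y \<le> 1\<close>.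
\<close>

lemma ex_positive_sqrt:
  fixes P :: "'a::{real_inner,banach} \<Rightarrow>\<^sub>L 'a"
  assumes P: "positive_symmetric P"
  shows "\<exists>S. positive_symmetric (blinfun_apply S) \<and> S o\<^sub>L S = P \<and>
    (\<forall>C. C o\<^sub>L P = P o\<^sub>L C \<longrightarrow> C o\<^sub>L S = S o\<^sub>L C)"
proof -
  \<comment> \<open>adding \<open>1\<close> keeps \<open>M\<close> positive when \<open>P = 0\<close>\<close>
  define M where "M = norm P + 1"
  have M: "0 < M" by (simp add: M_def add_nonneg_pos)
  have nP: "norm (P x) \<le> M * norm x" for x
    using norm_blinfun[of P x] by (simp add: M_def distrib_right add_increasing2)
  define B where "B = id_blinfun - (1/M) *\<^sub>R P"
  have "norm (B x) \<le> norm x" for x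
    using positive_symmetric_compl_le[OF P blinfun.bounded_linear_right nP M]
    by (simp add: B_def blinfun.diff_left blinfun.scaleR_left)
  then have B: "norm B \<le> 1"
    by (intro norm_blinfun_bound) auto
  obtain Y where Y: "sqrt_iter B \<longlonglongrightarrow> Y"
    using convergent_sqrt_iter[OF B] by (auto simp: convergent_def)
  have comp: "(\<lambda>n. f n o\<^sub>L g n) \<longlonglongrightarrow> (F o\<^sub>L G)" if "f \<longlonglongrightarrow> F" "g \<longlonglongrightarrow> G"
    for f g :: "nat \<Rightarrow> 'a \<Rightarrow>\<^sub>L 'a" and F G
    using bounded_bilinear.tendsto[OF bounded_bilinear_blinfun_compose] that .
  have "(\<lambda>n. sqrt_iter B (Suc n)) \<longlonglongrightarrow> (1/2) *\<^sub>R (B + (Y o\<^sub>L Y))"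
    unfolding sqrt_iter.simps by (intro tendsto_intros comp Y)
  with LIMSEQ_Suc[OF Y] have fixY: "Y = (1/2) *\<^sub>R (B + (Y o\<^sub>L Y))"
    using LIMSEQ_unique by blast
  then have Y2: "Y o\<^sub>L Y = 2 *\<^sub>R Y - B"
    by (metis add_diff_cancel_left' scaleR_half_double scaleR_2 scaleR_right_distrib)
  have nY: "norm Y \<le> 1"
    using norm_sqrt_iter[OF B] sqrt_majorant_bounds order_trans
    by (intro LIMSEQ_le_const2[OF tendsto_norm[OF Y]]) blast
  note symP = positive_symmetric_sym[OF P]
  have symn: "inner (sqrt_iter B n x) y = inner x (sqrt_iter B n y)" for n x y
    by (induction n arbitrary: x y)
      (simp_all add: blinfun.scaleR_left blinfun.add_left blinfun.diff_left B_def
        inner_add_left inner_add_right inner_diff_left inner_diff_right symP)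
  have symY: "inner (Y x) y = inner x (Y y)" for x y
  proof (rule LIMSEQ_unique)
    show "(\<lambda>n. inner (sqrt_iter B n x) y) \<longlonglongrightarrow> inner (Y x) y"
      by (intro tendsto_intros blinfun.tendsto Y)
    show "(\<lambda>n. inner (sqrt_iter B n x) y) \<longlonglongrightarrow> inner x (Y y)"
      unfolding symn by (intro tendsto_intros blinfun.tendsto Y)
  qed
  define S where "S = sqrt M *\<^sub>R (id_blinfun - Y)"
  have S: "S x = sqrt M *\<^sub>R (x - Y x)" for x
    by (simp add: S_def blinfun.scaleR_left blinfun.diff_left)
  have "positive_symmetric S"
    unfolding positive_symmetric_def
  proof (intro conjI allI)
    fix x y
    show "inner (S x) y = inner x (S y)"
      by (simp add: S inner_diff_left inner_diff_right symY)
    have "inner (Y x) x \<le> norm (Y x) * norm x" by (rule norm_cauchy_schwarz)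
    also have "\<dots> \<le> (1 * norm x) * norm x"
      by (intro mult_right_mono norm_ge_zero order_trans[OF norm_blinfun] nY)
    finally show "0 \<le> inner (S x) x"
      using M by (simp add: S inner_diff_left dot_square_norm power2_eq_square)
  qed
  moreover have "S o\<^sub>L S = P"
  proof (rule blinfun_eqI)
    fix x
    have "Y (Y x) = 2 *\<^sub>R Y x - B x"
      using arg_cong[OF Y2, of "\<lambda>F. F x"] by (simp add: blinfun.diff_left blinfun.scaleR_left)
    then have "x - Y x - Y (x - Y x) = (1/M) *\<^sub>R P x"
      by (simp add: B_def blinfun.diff_left blinfun.diff_right blinfun.scaleR_left scaleR_2)
    moreover have "S (S x) = M *\<^sub>R (x - Y x - Y (x - Y x))"
      using M by (simp add: S blinfun.scaleR_right flip: scaleR_diff_right)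
    ultimately show "(S o\<^sub>L S) x = P x" using M by simp
  qed
  moreover have "C o\<^sub>L S = S o\<^sub>L C" if C: "C o\<^sub>L P = P o\<^sub>L C" for C
  proof -
    have CP: "C (P x) = P (C x)" for x
      using arg_cong[OF C, of "\<lambda>F. F x"] by simp
    have Cn: "C (sqrt_iter B n x) = sqrt_iter B n (C x)" for n x
      by (induction n arbitrary: x)
        (simp_all add: B_def blinfun.scaleR_left blinfun.add_left blinfun.diff_left CP
          blinfun.scaleR_right blinfun.add_right blinfun.diff_right)
    have CY: "C (Y x) = Y (C x)" for x
    proof (rule LIMSEQ_unique)
      show "(\<lambda>n. C (sqrt_iter B n x)) \<longlonglongrightarrow> C (Y x)"
        by (intro tendsto_intros blinfun.tendsto Y)
      show "(\<lambda>n. C (sqrt_iter B n x)) \<longlonglongrightarrow> Y (C x)"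
        unfolding Cn by (intro tendsto_intros blinfun.tendsto Y)
    qed
    show ?thesis
      by (rule blinfun_eqI) (simp add: S blinfun.scaleR_right blinfun.diff_right CY)
  qed
  ultimately show ?thesis by blast
qed

text \<open>
  By commutativity \<open>(S + R) (S - R) = S\<^sup>2 - R\<^sup>2 = 0\<close>. So at \<open>y = (S - R) x\<close> the nonnegative forms of \<open>S\<close>
  and \<open>R\<close> add up to zero. Hence both vanish there and \<open>S y = R y = 0\<close>, which gives
  \<open>(S - R)\<^sup>2 x = 0\<close> and, by symmetry, \<open>(S - R) x = 0\<close>.
\<close>

lemma commuting_positive_sqrt_unique:
  fixes R S :: "'a::real_inner \<Rightarrow>\<^sub>L 'a"
  assumes R: "positive_symmetric (blinfun_apply R)" and S: "positive_symmetric (blinfun_apply S)"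
    and eq: "R o\<^sub>L R = S o\<^sub>L S" and comm: "R o\<^sub>L S = S o\<^sub>L R"
  shows "R = S"
proof (rule blinfun_eqI)
  fix x
  have eq': "R (R x) = S (S x)" and comm': "R (S x) = S (R x)"
    using arg_cong[OF eq, of "\<lambda>F. F x"] arg_cong[OF comm, of "\<lambda>F. F x"] by simp_all
  let ?y = "S x - R x"
  have "S ?y + R ?y = 0"
    by (simp add: blinfun.diff_right eq' comm')
  then have "inner (S ?y) ?y + inner (R ?y) ?y = 0"
    by (metis inner_add_left inner_zero_left)
  moreover have "0 \<le> inner (S ?y) ?y" "0 \<le> inner (R ?y) ?y"
    using R S by (blast intro: positive_symmetric_nonneg)+
  ultimately have "inner (S ?y) ?y = 0" "inner (R ?y) ?y = 0"
    by linarith+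
  then have z: "S ?y = 0" "R ?y = 0"
    using positive_symmetric_form_eq_0 R S by blast+
  have "inner ?y ?y = inner x (S ?y - R ?y)"
    by (simp only: inner_diff_left inner_diff_right blinfun.diff_right positive_symmetric_sym[OF R] positive_symmetric_sym[OF S])
  then show "R x = S x" using z by simp
qed

section \<open>From real to complex inner products\<close>

text \<open>
  The real inner product determines the Hermitian form. Hence an identity between real
  inner products that is compatible with scalar multiplication lifts to the Hermitian form.
\<close>

lemma Im_cinner: "Im (cinner x y) = inner ((- \<i>) *\<^sub>C x) y"
  using Re_cinner[of "(- \<i>) *\<^sub>C x" y] by (simp only: cinner_scaleC_left) simp

lemma cinner_scaleC_right: "cinner x (c *\<^sub>C y) = cnj c * cinner x y"
  by (subst (1 2) cinner_commute) (simp add: cinner_scaleC_left)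

lemma cinner_add_right: "cinner x (y + z) = cinner x y + cinner x z"
  by (subst (1 2 3) cinner_commute) (simp add: cinner_add_left)

lemma norm_scaleC: "norm (c *\<^sub>C x) = cmod c * norm x"
proof -
  have "complex_of_real ((norm (c *\<^sub>C x))\<^sup>2) = c * cnj c * complex_of_real ((norm x)\<^sup>2)"
    by (simp only: cinner_self[symmetric] cinner_scaleC_left cinner_scaleC_right mult_ac)
  also have "\<dots> = complex_of_real ((cmod c * norm x)\<^sup>2)"
    by (simp only: complex_norm_square power_mult_distrib of_real_mult)
  finally have "(norm (c *\<^sub>C x))\<^sup>2 = (cmod c * norm x)\<^sup>2"
    by (simp only: of_real_eq_iff)
  then show ?thesis by simp
qed

lemma bounded_linear_scaleC: "bounded_linear (\<lambda>x. c *\<^sub>C (x :: 'a::complex_inner))"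
proof (rule bounded_linear_intro[where K = "cmod c"])
  fix r and x :: 'a
  show "c *\<^sub>C (r *\<^sub>R x) = r *\<^sub>R (c *\<^sub>C x)"
    by (simp add: scaleC_of_real[symmetric] scaleC_scaleC mult.commute)
qed (simp_all add: scaleC_add_right norm_scaleC mult.commute)

text \<open>
  Rotating \<open>x\<close> by a unimodular scalar makes \<open>cinner x y\<close> real and nonnegative, which reduces the
  estimate to the real Cauchy-Schwarz inequality.
\<close>

lemma norm_cinner_le: "cmod (cinner x y) \<le> norm x * norm y"
proof (cases "cinner x y = 0")
  case False
  define c where "c = cnj (sgn (cinner x y))"
  have "complex_of_real (cmod (cinner x y)) = c * cinner x y"
    using False by (simp add: c_def sgn_eq complex_norm_square[symmetric] power2_eq_square mult.commute)
  then have "cmod (cinner x y) = Re (cinner (c *\<^sub>C x) y)"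
    by (metis Re_complex_of_real cinner_scaleC_left)
  also have "\<dots> \<le> norm (c *\<^sub>C x) * norm y"
    by (simp add: Re_cinner norm_cauchy_schwarz)
  also have "\<dots> = norm x * norm y"
    using False by (simp add: norm_scaleC c_def norm_sgn)
  finally show ?thesis .
qed simp

text \<open>
  On a complex space, a form whose diagonal values are real is Hermitian. Here polarisation at
  \<open>x + \<i> y\<close> is enough, since only the real part of the symmetry is claimed.
\<close>

lemma positive_op_iff:
  "positive_op A \<longleftrightarrow> bounded_clinear A \<and> positive_symmetric A"
proof safe
  assume A: "positive_op A"
  then show lin: "bounded_clinear A" by (simp add: positive_op_def)
  then interpret A: bounded_linear A by (simp add: bounded_clinear_def)
  have Ac: "A (c *\<^sub>C x) = c *\<^sub>C A x" for c x
    using lin by (simp add: bounded_clinear_def)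
  have nn: "Im (cinner (A x) x) = 0" "0 \<le> Re (cinner (A x) x)" for x
    using A by (auto simp: positive_op_def complex_nonneg_Reals_iff)
  have "inner (A x) y = inner x (A y)" for x y
    using nn(1)[of "x + \<i> *\<^sub>C y"] nn(1)[of x] nn(1)[of y]
    by (simp add: A.add Ac cinner_add_left cinner_add_right cinner_scaleC_left cinner_scaleC_right
        Re_cinner inner_commute)
  with nn(2) show "positive_symmetric A"
    by (simp add: positive_symmetric_def Re_cinner)
next
  assume A: "bounded_clinear A" "positive_symmetric A"
  have Ac: "A (c *\<^sub>C x) = c *\<^sub>C A x" for c x
    using A(1) by (simp add: bounded_clinear_def)
  have "Im (cinner (A x) x) = 0" for x
  proof -
    have "Im (cinner (A x) x) = inner ((- \<i>) *\<^sub>C x) (A x)"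
      using A(2) by (simp add: Im_cinner Ac[symmetric] positive_symmetric_def)
    also have "\<dots> = Im (cinner x (A x))" by (simp add: Im_cinner)
    also have "\<dots> = - Im (cinner (A x) x)"
      by (subst cinner_commute) simp
    finally show ?thesis by simp
  qed
  with A show "positive_op A"
    by (simp add: positive_op_def positive_symmetric_nonneg complex_nonneg_Reals_iff Re_cinner)
qed

text \<open>
  The commutation property of the constructed root is used twice. Multiplication by a complex scalar
  commutes with \<open>P\<close>, so the root is complex linear; any other positive root \<open>R\<close> commutes with \<open>P = R\<^sup>2\<close>,
  so it commutes with the constructed one and coincides with it.
\<close>

lemma op_sqrt_positive:
  fixes P :: "'a::complex_hilbert \<Rightarrow> 'a"
  assumes P: "positive_op P"
  shows "positive_op (op_sqrt P) \<and> op_sqrt P \<circ> op_sqrt P = P"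
proof -
  have blP: "bounded_linear P" and Pc: "\<And>c x. P (c *\<^sub>C x) = c *\<^sub>C P x" and psP: "positive_symmetric P"
    using P by (auto simp: positive_op_iff bounded_clinear_def)
  define P' where "P' = Blinfun P"
  have P': "blinfun_apply P' = P" by (simp add: P'_def bounded_linear_Blinfun_apply blP)
  obtain S where S: "positive_symmetric (blinfun_apply S)" "S o\<^sub>L S = P'"
    and comm: "\<And>C. C o\<^sub>L P' = P' o\<^sub>L C \<Longrightarrow> C o\<^sub>L S = S o\<^sub>L C"
    using ex_positive_sqrt[of P'] psP P' by metis
  have "S (c *\<^sub>C x) = c *\<^sub>C S x" for c x
  proof -
    let ?C = "Blinfun (\<lambda>x. c *\<^sub>C x) :: 'a \<Rightarrow>\<^sub>L 'a"
    have C: "?C x = c *\<^sub>C x" for x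
      by (simp add: bounded_linear_Blinfun_apply bounded_linear_scaleC)
    have "?C o\<^sub>L P' = P' o\<^sub>L ?C"
      by (rule blinfun_eqI) (simp add: C P' Pc)
    from arg_cong[OF comm[OF this], of "\<lambda>F. F x"] show ?thesis by (simp add: C)
  qed
  then have "bounded_clinear S"
    by (simp add: bounded_clinear_def blinfun.bounded_linear_right)
  with S have pS: "positive_op S" by (simp add: positive_op_iff)
  have S2: "S \<circ> S = P"
    using arg_cong[OF S(2), of blinfun_apply] P' by (auto simp: fun_eq_iff)
  have uniq: "R = S" if R: "positive_op R" "R \<circ> R = P" for R
  proof -
    have blR: "bounded_linear R" using R by (simp add: positive_op_def bounded_clinear_def)
    define R' where "R' = Blinfun R"
    have R': "blinfun_apply R' = R" by (simp add: R'_def bounded_linear_Blinfun_apply blR)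
    have RR: "R' o\<^sub>L R' = P'"
      by (rule blinfun_eqI) (use R(2) in \<open>auto simp: R' P'\<close>)
    then have "R' o\<^sub>L P' = P' o\<^sub>L R'"
      by (intro blinfun_eqI) (simp flip: RR)
    then have "R' o\<^sub>L S = S o\<^sub>L R'" by (rule comm)
    moreover have "positive_symmetric R'" using R R' by (simp add: positive_op_iff)
    ultimately have "R' = S"
      using commuting_positive_sqrt_unique S RR by metis
    then show ?thesis using R' by blast
  qed
  have "op_sqrt P = S"
    unfolding op_sqrt_def
    by (rule the_equality) (rule conjI[OF pS S2], erule conjE, rule uniq)
  show ?thesis unfolding \<open>op_sqrt P = S\<close> by (rule conjI[OF pS S2])
qed

section \<open>Adjoint, absolute value and partial isometries\<close>

lemma ex_cadjoint:
  fixes T :: "'a::complex_hilbert \<Rightarrow> 'a"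
  assumes T: "bounded_clinear T"
  shows "\<exists>S. \<forall>x y. cinner (T x) y = cinner x (S y)"
proof -
  have bl: "bounded_linear T" and Tc: "\<And>c x. T (c *\<^sub>C x) = c *\<^sub>C T x"
    using T by (auto simp: bounded_clinear_def)
  have "\<exists>z. \<forall>x. inner (T x) y = inner x z" for y
    by (rule ex_riesz_representative)
      (rule bounded_linear_compose[OF bounded_linear_inner_left bl])
  then obtain S where S: "\<And>x y. inner (T x) y = inner x (S y)" by metis
  have "cinner (T x) y = cinner x (S y)" for x y
    by (rule complex_eqI) (simp_all only: Re_cinner Im_cinner Tc[symmetric] S)
  then show ?thesis by blast
qed

lemma cinner_cadjoint:
  fixes T :: "'a::complex_hilbert \<Rightarrow> 'a"
  assumes T: "bounded_clinear T"
  shows "cinner (T x) y = cinner x (cadjoint T y)"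
proof -
  obtain S where S: "\<forall>x y. cinner (T x) y = cinner x (S y)" using ex_cadjoint[OF T] by blast
  have "S' = S" if "\<forall>x y. cinner (T x) y = cinner x (S' y)" for S'
  proof
    fix y
    have "inner x (S' y) = inner x (S y)" for x
      using S that by (metis Re_cinner)
    then show "S' y = S y" by (metis inner_commute vector_eq_ldot)
  qed
  then have "cadjoint T = S"
    unfolding cadjoint_def using S by (intro the_equality) auto
  with S show ?thesis by blast
qed

lemma bounded_clinear_cadjoint:
  fixes T :: "'a::complex_hilbert \<Rightarrow> 'a"
  assumes T: "bounded_clinear T"
  shows "bounded_clinear (cadjoint T)"
proof -
  let ?S = "cadjoint T"
  note S = cinner_cadjoint[OF T]
  have iS: "inner (T x) y = inner x (?S y)" for x y
    using S by (metis Re_cinner)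
  have ext: "u = v" if "\<And>x. cinner x u = cinner x v" for u v :: 'a
    using that by (metis Re_cinner inner_commute vector_eq_ldot)
  have bl: "bounded_linear T" using T by (simp add: bounded_clinear_def)
  have add: "?S (x + y) = ?S x + ?S y" for x y
    by (rule ext) (simp add: S[symmetric] cinner_add_right)
  have scC: "?S (c *\<^sub>C x) = c *\<^sub>C ?S x" for c x
    by (rule ext) (simp add: S[symmetric] cinner_scaleC_right)
  have "norm (?S y) \<le> norm y * onorm T" for y
  proof (cases "?S y = 0")
    case False
    have "norm (?S y) * norm (?S y) = inner (T (?S y)) y"
      by (simp add: iS dot_square_norm power2_eq_square)
    also have "\<dots> \<le> norm (T (?S y)) * norm y" by (rule norm_cauchy_schwarz)
    also have "\<dots> \<le> (onorm T * norm (?S y)) * norm y"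
      by (intro mult_right_mono onorm bl) simp
    finally show ?thesis using False by (simp add: mult.commute mult.left_commute)
  qed (simp add: onorm_pos_le bl)
  then have "bounded_linear ?S"
    by (intro bounded_linear_intro[where K = "onorm T"])
      (simp_all add: add scC flip: scaleC_of_real)
  with scC show ?thesis by (simp add: bounded_clinear_def)
qed

lemma abs_op_positive:
  fixes T :: "'a::complex_hilbert \<Rightarrow> 'a"
  assumes T: "bounded_clinear T"
  shows "positive_op (abs_op T)" and norm_abs_op: "norm (abs_op T x) = norm (T x)"
proof -
  have "bounded_clinear (cadjoint T \<circ> T)"
    using T bounded_clinear_cadjoint[OF T]
    by (auto simp: bounded_clinear_def o_def intro: bounded_linear_compose)
  moreover have form: "cinner ((cadjoint T \<circ> T) x) x = complex_of_real ((norm (T x))\<^sup>2)" for x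
    by (subst cinner_commute) (simp add: cinner_cadjoint[OF T, symmetric] cinner_self)
  ultimately have "positive_op (cadjoint T \<circ> T)"
    by (simp add: positive_op_def complex_nonneg_Reals_iff)
  from op_sqrt_positive[OF this]
  have pos: "positive_op (abs_op T)" and sq: "abs_op T \<circ> abs_op T = cadjoint T \<circ> T"
    by (simp_all add: abs_op_def)
  show "positive_op (abs_op T)" by (rule pos)
  have "(norm (abs_op T x))\<^sup>2 = inner (abs_op T (abs_op T x)) x"
    using pos by (simp add: positive_op_iff positive_symmetric_def power2_norm_eq_inner)
  also have "\<dots> = (norm (T x))\<^sup>2"
    using form[of x] sq by (metis Re_cinner Re_complex_of_real comp_apply)
  finally show "norm (abs_op T x) = norm (T x)" by simp
qed

lemma norm_op_sqrt_le:
  fixes P :: "'a::complex_hilbert \<Rightarrow> 'a"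
  assumes P: "positive_op P"
  shows "norm (op_sqrt P x) \<le> sqrt (onorm P) * norm x"
proof -
  have A: "positive_symmetric (op_sqrt P)" and sq: "op_sqrt P (op_sqrt P x) = P x"
    using op_sqrt_positive[OF P] by (auto simp: positive_op_iff fun_eq_iff)
  have bl: "bounded_linear P" using P by (simp add: positive_op_def bounded_clinear_def)
  have "(norm (op_sqrt P x))\<^sup>2 = inner (P x) x"
    using A sq by (metis positive_symmetric_def power2_norm_eq_inner)
  also have "\<dots> \<le> norm (P x) * norm x" by (rule norm_cauchy_schwarz)
  also have "\<dots> \<le> (onorm P * norm x) * norm x"
    by (intro mult_right_mono onorm bl) simp
  also have "\<dots> = (sqrt (onorm P) * norm x)\<^sup>2"
    by (simp add: power_mult_distrib onorm_pos_le bl power2_eq_square[of "norm x"])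
  finally show ?thesis
    by (rule power2_le_imp_le) (simp add: onorm_pos_le bl)
qed

text \<open>
  Subtracting the projection of \<open>x\<close> onto the kernel does not change \<open>U x\<close> and leads to the orthogonal
  complement, where \<open>U\<close> is isometric; the projection itself only adds to the norm of \<open>x\<close>.
\<close>

lemma partial_isometry_norm_le:
  fixes U :: "'a::complex_hilbert \<Rightarrow> 'a"
  assumes U: "partial_isometry U"
  shows "norm (U x) \<le> norm x"
proof -
  have Uc: "\<And>c x. U (c *\<^sub>C x) = c *\<^sub>C U x" and bl: "bounded_linear U"
    and iso: "\<And>x. (\<forall>y. U y = 0 \<longrightarrow> cinner x y = 0) \<Longrightarrow> norm (U x) = norm x"
    using U unfolding partial_isometry_def bounded_clinear_def by blast+
  interpret U: bounded_linear U by (rule bl)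
  have "closed (U -` {0})"
    by (intro closed_vimage U.continuous_on closed_singleton continuous_on_id)
  moreover have "subspace (U -` {0})"
    by (auto simp: subspace_def U.add U.scaleR U.zero)
  ultimately obtain p where p: "U p = 0" "\<And>y. U y = 0 \<Longrightarrow> inner (x - p) y = 0"
    using ex_orthogonal_projection[of "U -` {0}" x] by auto
  have "cinner (x - p) y = 0" if y: "U y = 0" for y
  proof (rule complex_eqI)
    show "Re (cinner (x - p) y) = Re 0" using p(2)[OF y] by (simp add: Re_cinner)
    \<comment> \<open>the projection is orthogonal for the real inner product only; testing it against \<open>\<i> y\<close>
       gives the imaginary part\<close>
    have "U (\<i> *\<^sub>C y) = 0"
      using y Uc norm_scaleC[of \<i> 0] by simp
    then have "Re (cinner (x - p) (\<i> *\<^sub>C y)) = 0" using p(2) by (simp add: Re_cinner)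
    then show "Im (cinner (x - p) y) = Im 0" by (simp add: cinner_scaleC_right)
  qed
  then have "norm (U x) = norm (x - p)"
    using iso[of "x - p"] p(1) by (simp add: U.diff)
  moreover have "(norm x)\<^sup>2 = (norm (x - p))\<^sup>2 + (norm p)\<^sup>2"
    using p(2)[OF p(1)]
    by (simp add: power2_norm_eq_inner inner_diff_left inner_diff_right inner_commute)
  ultimately have "(norm (U x))\<^sup>2 \<le> (norm x)\<^sup>2" by simp
  then show ?thesis by (rule power2_le_imp_le) simp
qed

section \<open>Estimates for the numerical radius\<close>

lemma cmod_cinner_le_onorm:
  assumes "bounded_linear X" "norm x = 1"
  shows "cmod (cinner (X x) x) \<le> onorm X"
  using norm_cinner_le[of "X x" x] onorm[OF assms(1), of x] assms(2) by simp

lemma bdd_above_numerical_range: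
  assumes "bounded_linear X"
  shows "bdd_above (insert 0 {cmod (cinner (X x) x) |x. norm x = 1})"
proof (rule bdd_aboveI)
  fix r assume "r \<in> insert 0 {cmod (cinner (X x) x) |x. norm x = 1}"
  then show "r \<le> onorm X"
    by (auto intro: cmod_cinner_le_onorm[OF assms] onorm_pos_le[OF assms])
qed

lemma cmod_cinner_le_numerical_radius:
  assumes "bounded_linear X" "norm x = 1"
  shows "cmod (cinner (X x) x) \<le> numerical_radius X"
  unfolding numerical_radius_def
  by (rule cSup_upper[OF _ bdd_above_numerical_range[OF assms(1)]]) (use assms(2) in blast)

lemma numerical_radius_le:
  assumes "0 \<le> b" "\<And>x. norm x = 1 \<Longrightarrow> cmod (cinner (X x) x) \<le> b"
  shows "numerical_radius X \<le> b"
  unfolding numerical_radius_def using assms by (intro cSup_least) auto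

lemma numerical_radius_nonneg:
  assumes "bounded_linear X"
  shows "0 \<le> numerical_radius X"
  unfolding numerical_radius_def
  by (rule cSup_upper[OF _ bdd_above_numerical_range[OF assms]]) auto

lemma numerical_radius_le_onorm:
  assumes "bounded_linear X"
  shows "numerical_radius X \<le> onorm X"
  using cmod_cinner_le_onorm[OF assms] onorm_pos_le[OF assms] by (intro numerical_radius_le)

text \<open>
  In the splitting \<open>C A = (a/2) C + C (A - a/2)\<close> the first summand is measured by the numerical radius
  of \<open>C\<close> and the second by its norm. The scalar part of \<open>A\<close> is what makes this possible:
  the numerical radius is not submultiplicative, but it is homogeneous.
\<close>

lemma numerical_radius_comp_positive_le:
  fixes A C :: "'a::complex_hilbert \<Rightarrow> 'a"
  assumes C: "bounded_linear C" and A: "positive_op A" "\<And>x. norm (A x) \<le> a * norm x" and a: "0 \<le> a"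
  shows "numerical_radius (C \<circ> A) \<le> a/2 * (onorm C + numerical_radius C)"
proof (rule numerical_radius_le)
  interpret C: bounded_linear C by fact
  show "0 \<le> a/2 * (onorm C + numerical_radius C)"
    using a C by (simp add: onorm_pos_le numerical_radius_nonneg)
  fix x :: 'a assume x: "norm x = 1"
  show "cmod (cinner ((C \<circ> A) x) x) \<le> a/2 * (onorm C + numerical_radius C)"
  proof (cases "a = 0")
    case True
    then have "A x = 0" using A(2)[of x] by simp
    then show ?thesis using True norm_cinner_le[of 0 x] by (simp add: C.zero)
  next
    case False
    let ?r = "A x - (a/2) *\<^sub>R x"
    have "norm ?r \<le> a/2 * norm x"
      using A a False by (intro positive_symmetric_reflect_le) (auto simp: positive_op_iff bounded_clinear_def)
    then have r: "norm ?r \<le> a/2" using x by simp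
    have "C (A x) = C ?r + complex_of_real (a/2) *\<^sub>C C x"
      by (simp only: scaleC_of_real C.diff C.scaleR) simp
    then have "cinner ((C \<circ> A) x) x = cinner (C ?r) x + complex_of_real (a/2) * cinner (C x) x"
      by (simp only: o_def cinner_add_left cinner_scaleC_left)
    then have "cmod (cinner ((C \<circ> A) x) x) \<le> cmod (cinner (C ?r) x) + a/2 * cmod (cinner (C x) x)"
      using norm_triangle_ineq[of "cinner (C ?r) x" "complex_of_real (a/2) * cinner (C x) x"] a
      by (simp add: norm_mult)
    moreover have "cmod (cinner (C ?r) x) \<le> onorm C * (a/2)"
    proof -
      have "cmod (cinner (C ?r) x) \<le> norm (C ?r)"
        using norm_cinner_le[of "C ?r" x] x by simp
      also have "\<dots> \<le> onorm C * norm ?r" by (rule onorm[OF C])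
      also have "\<dots> \<le> onorm C * (a/2)"
        by (intro mult_left_mono r onorm_pos_le C)
      finally show ?thesis .
    qed
    moreover have "a/2 * cmod (cinner (C x) x) \<le> a/2 * numerical_radius C"
      using cmod_cinner_le_numerical_radius[OF C x] a by (intro mult_left_mono) auto
    ultimately show ?thesis by (simp add: distrib_left mult.commute)
  qed
qed

theorem corollary3p6:
  fixes T U :: "'a::complex_hilbert \<Rightarrow> 'a"
  assumes "bounded_clinear T"
    and "partial_isometry U"
    and "T = U \<circ> abs_op T"
  shows "numerical_radius T
           \<le> 1/2 * (onorm T + sqrt (onorm T) * numerical_radius (U \<circ> op_sqrt (abs_op T)))
       \<and> 1/2 * (onorm T + sqrt (onorm T) * numerical_radius (U \<circ> op_sqrt (abs_op T)))
           \<le> 1/2 * (onorm T + sqrt (onorm T) * onorm (U \<circ> op_sqrt (abs_op T)))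
       \<and> 1/2 * (onorm T + sqrt (onorm T) * onorm (U \<circ> op_sqrt (abs_op T)))
           \<le> 1/2 * (onorm T + sqrt (onorm T) * (onorm U * sqrt (onorm T)))
       \<and> 1/2 * (onorm T + sqrt (onorm T) * (onorm U * sqrt (onorm T)))
           \<le> onorm T"
proof -
  define A where "A = op_sqrt (abs_op T)"
  define a where "a = sqrt (onorm T)"
  have blT: "bounded_linear T" and blU: "bounded_linear U"
    using assms by (auto simp: bounded_clinear_def partial_isometry_def)
  have T0: "0 \<le> onorm T" by (rule onorm_pos_le[OF blT])
  have a: "0 \<le> a" "a * a = onorm T" using T0 by (auto simp: a_def)
  have pos: "positive_op (abs_op T)" by (rule abs_op_positive[OF assms(1)])
  have A: "positive_op A" and AA: "A \<circ> A = abs_op T"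
    using op_sqrt_positive[OF pos] by (auto simp: A_def)
  have blA: "bounded_linear A" using A by (simp add: positive_op_def bounded_clinear_def)
  have "onorm (abs_op T) = onorm T"
    by (simp add: onorm_def norm_abs_op[OF assms(1)])
  then have nA: "norm (A x) \<le> a * norm x" for x
    using norm_op_sqrt_le[OF pos] by (simp add: A_def a_def)
  have blUA: "bounded_linear (U \<circ> A)"
    using bounded_linear_compose[OF blU blA] by (simp add: o_def)
  have U0: "0 \<le> onorm U" by (rule onorm_pos_le[OF blU])
  have U1: "onorm U \<le> 1"
    using partial_isometry_norm_le[OF assms(2)] by (intro onorm_bound) auto
  have "onorm (U \<circ> A) \<le> onorm U * onorm A"
    by (rule onorm_compose[OF blU blA])
  also have "onorm A \<le> a"
    using nA a by (intro onorm_bound) auto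
  finally have UA: "onorm (U \<circ> A) \<le> onorm U * a"
    using U0 by (simp add: mult_left_mono)
  then have UA': "onorm (U \<circ> A) \<le> a"
    using mult_right_mono[OF U1 a(1)] by simp
  have "T = (U \<circ> A) \<circ> A"
    using assms(3) AA by (simp add: comp_assoc)
  then have "numerical_radius T \<le> a/2 * (onorm (U \<circ> A) + numerical_radius (U \<circ> A))"
    using numerical_radius_comp_positive_le[OF blUA A nA a(1)] by simp
  also have "\<dots> \<le> a/2 * (a + numerical_radius (U \<circ> A))"
    using UA' a(1) by (intro mult_left_mono) auto
  also have "\<dots> = 1/2 * (onorm T + a * numerical_radius (U \<circ> A))"
    by (simp add: a(2)[symmetric] algebra_simps)
  finally have 1: "numerical_radius T \<le> 1/2 * (onorm T + a * numerical_radius (U \<circ> A))" .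
  have 2: "1/2 * (onorm T + a * numerical_radius (U \<circ> A)) \<le> 1/2 * (onorm T + a * onorm (U \<circ> A))"
    using numerical_radius_le_onorm[OF blUA] a(1) by (simp add: mult_left_mono)
  have 3: "1/2 * (onorm T + a * onorm (U \<circ> A)) \<le> 1/2 * (onorm T + a * (onorm U * a))"
    using UA a(1) by (simp add: mult_left_mono)
  have "a * (onorm U * a) = onorm U * onorm T"
    by (simp add: a(2)[symmetric])
  also have "\<dots> \<le> onorm T"
    using mult_right_mono[OF U1 T0] by simp
  finally have 4: "1/2 * (onorm T + a * (onorm U * a)) \<le> onorm T" by simp
  show ?thesis
    using 1 2 3 4 unfolding A_def a_def by blast
qed

end
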